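(* Let $N$ be odd, and for $N$-periodic sequences $\boldsymbol u=\{u_n\}_{n\in\mathbb Z}$ define the discrete Hilbert transform by $$(H_{\Delta x}\boldsymbol u)_n=\sum_{j=0}^{N-1}d_{n-j}u_j,\qquad d_n=\begin{cases}\frac1N\cot\left(\frac{\pi n}{2N}\right),&\text{if } n \text{ is odd},\\ -\frac1N\tan\left(\frac{\pi n}{2N}\right),&\text{if } n\text{ is even}.\end{cases}$$ Then $$H_{\Delta x}\boldsymbol u=F_{\Delta x}^{-1}(-\mathrm i\,S_{\mathrm{odd}})F_{\Delta x}\boldsymbol u,$$ where $$S_{\mathrm{odd}}=\mathrm{diag}(0,\underbrace{1,\dots,1}_{\frac{N-1}{2}},\underbrace{-1,\dots,-1}_{\frac{N-1}{2}}).$$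
   Context: $F_{\Delta x}$ is the discrete Fourier transform on $N$-periodic sequences, $(F_{\Delta x}\boldsymbol u)_k=\sum_{n=0}^{N-1}u_n\mathrm e^{-2\pi\mathrm i nk/N}$, with inverse $(F_{\Delta x}^{-1}\boldsymbol v)_n=\frac1N\sum_{k=0}^{N-1}v_k\mathrm e^{2\pi\mathrm i nk/N}$. Diagonal matrices act on the components with indices $0,1,\dots,N-1$ (extended $N$-periodically). *)

theory Defs
  imports Complex_Main "HOL-Library.Periodic_Fun"
begin

text \<open>
  Sequences are functions on the integers; \<open>N\<close>-periodicity of \<open>u\<close> is the library's
  \<open>periodic_fun_simple u (int N)\<close>, i.e. \<open>u (n + int N) = u n\<close> for all \<open>n\<close>.
\<close>

definition dft :: "nat \<Rightarrow> (int \<Rightarrow> complex) \<Rightarrow> int \<Rightarrow> complex" where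
  "dft N u k = (\<Sum>n = 0..<int N. u n * exp (- 2 * pi * \<i> * of_int n * of_int k / of_nat N))"

definition idft :: "nat \<Rightarrow> (int \<Rightarrow> complex) \<Rightarrow> int \<Rightarrow> complex" where
  "idft N v n = 1 / of_nat N * (\<Sum>k = 0..<int N. v k * exp (2 * pi * \<i> * of_int n * of_int k / of_nat N))"

definition hilbert_kernel :: "nat \<Rightarrow> int \<Rightarrow> real" where
  "hilbert_kernel N n =
     (if odd n then 1 / real N * cot (pi * of_int n / (2 * real N))
      else - (1 / real N) * tan (pi * of_int n / (2 * real N)))"

definition discrete_hilbert :: "nat \<Rightarrow> (int \<Rightarrow> complex) \<Rightarrow> int \<Rightarrow> complex" where
  "discrete_hilbert N u n = (\<Sum>j = 0..<int N. complex_of_real (hilbert_kernel N (n - j)) * u j)"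

text \<open>
  A diagonal matrix is represented by the list of its \<open>N\<close> diagonal entries. It multiplies the
  components with indices \<open>0, \<dots>, N - 1\<close>, and the result is extended \<open>N\<close>-periodically.
\<close>

definition diag_apply :: "complex list \<Rightarrow> (int \<Rightarrow> complex) \<Rightarrow> int \<Rightarrow> complex" where
  "diag_apply ds v k = (let r = k mod int (length ds) in ds ! nat r * v r)"

definition S_odd :: "nat \<Rightarrow> complex list" where
  "S_odd N = 0 # replicate ((N - 1) div 2) 1 @ replicate ((N - 1) div 2) (- 1)"

end

theory Submission
  imports Defs
begin

text \<open>
  The discrete Fourier transform turns a diagonal matrix into convolution with the inverse
  transform of its diagonal (\<open>idft_mult_dft\<close>), so it has to be shown that the inverse transform
  of the diagonal \<open>-\<i> S_odd\<close> is the cotangent-tangent kernel (\<open>idft_S_odd\<close>).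

  Write \<open>N = 2 M + 1\<close> and \<open>w = exp (2 \<pi> \<i> n / N)\<close>. Since \<open>N\<close> is odd, \<open>w\<close> has a square root
  \<open>q\<close> that is itself an \<open>N\<close>-th root of unity, namely \<open>q = w ^ (M + 1)\<close>. In terms of \<open>q\<close>, the
  powers \<open>w ^ k\<close> with \<open>1 \<le> k \<le> M\<close> are the even powers \<open>q ^ 2, \<dots>, q ^ (2 M)\<close>, and those with
  \<open>M < k \<le> 2 M\<close> are, because \<open>q ^ N = 1\<close>, the odd powers \<open>q, \<dots>, q ^ (2 M - 1)\<close>. The signs of
  \<open>S_odd\<close> thus make the sum an alternating geometric sum in \<open>q\<close>, whose value is
  \<open>(1 - q) / (1 + q)\<close> (\<open>signed_sum_root_of_unity\<close>). Finally \<open>q = (-1) ^ n * cis (\<pi> n / N)\<close>, so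
  the quotient is a half-angle tangent or cotangent, according to the parity of \<open>n\<close>.
\<close>

lemma sum_int_atLeastLessThan_nat: "(\<Sum>k = 0..<int N. f k) = (\<Sum>k<N. f (int k))"
  by (rule sum.reindex_bij_witness[of _ int nat]) auto

lemma sum_lessThan_add:
  fixes f :: "nat \<Rightarrow> 'a::comm_monoid_add"
  shows "(\<Sum>k<m + n. f k) = (\<Sum>k<m. f k) + (\<Sum>k<n. f (m + k))"
  by (induction n) (simp_all add: add.assoc)

lemma idft_mult_dft:
  "idft N (\<lambda>k. a k * dft N u k) n = (\<Sum>j = 0..<int N. idft N a (n - j) * u j)"
proof -
  have "idft N (\<lambda>k. a k * dft N u k) n =
      (\<Sum>k = 0..<int N. \<Sum>j = 0..<int N. 1 / of_nat N * (a k * u j *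
        (exp (- 2 * pi * \<i> * of_int j * of_int k / of_nat N) *
         exp (2 * pi * \<i> * of_int n * of_int k / of_nat N))))"
    unfolding idft_def dft_def sum_distrib_left sum_distrib_right
    by (intro sum.cong refl) (simp add: mult_ac)
  also have "\<dots> = (\<Sum>j = 0..<int N. \<Sum>k = 0..<int N. 1 / of_nat N * (a k * u j *
        (exp (- 2 * pi * \<i> * of_int j * of_int k / of_nat N) *
         exp (2 * pi * \<i> * of_int n * of_int k / of_nat N))))"
    by (rule sum.swap)
  also have "\<dots> = (\<Sum>j = 0..<int N. idft N a (n - j) * u j)"
    unfolding idft_def sum_distrib_left sum_distrib_right exp_add[symmetric]
    by (intro sum.cong refl)
      (simp add: mult_ac ring_distribs diff_divide_distrib flip: add_divide_distrib)
  finally show ?thesis .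
qed

text \<open>
  Modulo \<open>q ^ (2 * M + 1) = 1\<close> the subtracted terms are the odd powers of \<open>q\<close>, so the
  difference is the sum of \<open>(- q) ^ l\<close> for \<open>1 \<le> l \<le> 2 * M\<close>.
\<close>
lemma signed_sum_root_of_unity:
  fixes q :: "'a::comm_ring_1"
  assumes "q ^ (2 * M + 1) = 1"
  shows "(1 + q) * ((\<Sum>k<M. (q\<^sup>2) ^ (k + 1)) - (\<Sum>k<M. (q\<^sup>2) ^ (M + k + 1))) = 1 - q"
proof -
  have "(q\<^sup>2) ^ (M + k + 1) = q ^ (2 * M + 1) * q ^ (2 * k + 1)" for k
    unfolding power_mult[symmetric] power_add[symmetric] by (rule arg_cong) simp
  then have odd_power: "(q\<^sup>2) ^ (M + k + 1) = q ^ (2 * k + 1)" for k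
    using assms by simp
  have even_power: "(q\<^sup>2) ^ (k + 1) = q ^ (2 * k + 2)" for k
    unfolding power_mult[symmetric] by simp
  have telescope: "(1 + q) * (\<Sum>k<L. q ^ (2 * k + 2) - q ^ (2 * k + 1)) = q ^ (2 * L + 1) - q" for L
    by (induction L) (auto simp: algebra_simps)
  have "(1 + q) * ((\<Sum>k<M. (q\<^sup>2) ^ (k + 1)) - (\<Sum>k<M. (q\<^sup>2) ^ (M + k + 1))) =
      (1 + q) * (\<Sum>k<M. q ^ (2 * k + 2) - q ^ (2 * k + 1))"
    unfolding odd_power unfolding even_power by (simp only: sum_subtractf)
  also have "\<dots> = 1 - q"
    using assms by (simp only: telescope)
  finally show ?thesis .
qed

text \<open>
  Both half-angle formulas hold at the poles as well, since there the denominator on the left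
  vanishes too and both sides are \<open>0\<close>.
\<close>
lemma cayley_cis_tan:
  "(1 - cis (2 * t)) / (1 + cis (2 * t)) = - \<i> * complex_of_real (tan t)"
proof -
  have num: "1 - cis (2 * t) = - 2 * \<i> * sin t * cis t"
    by (simp add: complex_eq_iff cos_double_sin sin_double power2_eq_square)
  have den: "1 + cis (2 * t) = 2 * cos t * cis t"
    by (simp add: complex_eq_iff cos_double_cos sin_double power2_eq_square)
  show ?thesis unfolding num den by (simp add: tan_def)
qed

lemma cayley_cis_cot:
  "(1 + cis (2 * t)) / (1 - cis (2 * t)) = \<i> * complex_of_real (cot t)"
proof -
  have "(1 + cis (2 * t)) / (1 - cis (2 * t)) = inverse ((1 - cis (2 * t)) / (1 + cis (2 * t)))"
    by simp
  then show ?thesis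
    unfolding cayley_cis_tan
    by (simp add: cot_def tan_def divide_inverse)
qed

text \<open>
  This is the case of the theorem in which \<open>u\<close> is the periodic unit impulse at \<open>0\<close>;
  by \<open>idft_mult_dft\<close> the case of general \<open>u\<close> reduces to it.
\<close>
lemma idft_S_odd:
  assumes "odd N"
  shows "idft N (\<lambda>k. map (\<lambda>s. - \<i> * s) (S_odd N) ! nat k) n = complex_of_real (hilbert_kernel N n)"
proof -
  obtain M where N: "N = 2 * M + 1"
    using assms by (elim oddE)
  define t where "t = pi * of_int n / (2 * real N)"
  \<comment> \<open>Of the two square roots \<open>\<plusminus> cis (2 * t)\<close> of \<open>exp (2 \<pi> \<i> n / N)\<close>,
      the sign selects the one that is an \<open>N\<close>-th root of unity.\<close>
  define q where "q = (-1) powi n * cis (2 * t)"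
  have "real N > 0" using N by simp
  have w: "exp (2 * pi * \<i> * of_int n * of_int (int k) / of_nat N) = (q\<^sup>2) ^ k" for k
  proof -
    have "((-1) powi n :: complex)\<^sup>2 = 1" by (cases "even n") auto
    then have "q\<^sup>2 = cis (4 * t)" unfolding q_def power_mult_distrib by (simp add: DeMoivre)
    then have "(q\<^sup>2) ^ k = cis (real k * (4 * t))" by (simp only: DeMoivre)
    then show ?thesis
      by (simp add: t_def cis_conv_exp field_simps)
  qed
  have "cis (2 * t) ^ N = cis (pi * of_int n)"
    using \<open>real N > 0\<close> by (simp add: DeMoivre t_def)
  also have "\<dots> = (-1) powi n"
    by (cases "even n") (auto elim!: evenE oddE simp: complex_eq_iff cos_add sin_add algebra_simps)
  finally have "cis (2 * t) ^ N = (-1) powi n" .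
  then have q_root: "q ^ N = 1"
    using assms unfolding q_def power_mult_distrib by (cases "even n") auto
  have "1 + q \<noteq> 0"
  proof
    assume "1 + q = 0"
    then have "q = -1" by (simp add: add_eq_0_iff)
    then show False using q_root assms by simp
  qed
  \<comment> \<open>The index \<open>k = 0\<close> contributes nothing; the remaining indices form two blocks of length \<open>M\<close>.\<close>
  have "(\<Sum>k = 0..<int N. map (\<lambda>s. - \<i> * s) (S_odd N) ! nat k *
          exp (2 * pi * \<i> * of_int n * of_int k / of_nat N)) =
      (\<Sum>k<Suc (M + M). map (\<lambda>s. - \<i> * s) (S_odd N) ! k * (q\<^sup>2) ^ k)"
    unfolding sum_int_atLeastLessThan_nat w by (simp only: nat_int N Suc_eq_plus1 mult_2)
  also have "\<dots> = - \<i> * ((\<Sum>k<M. (q\<^sup>2) ^ (k + 1)) - (\<Sum>k<M. (q\<^sup>2) ^ (M + k + 1)))"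
    unfolding sum.lessThan_Suc_shift sum_lessThan_add
    by (simp add: S_odd_def N nth_append sum_negf sum_distrib_left algebra_simps)
  also have "\<dots> = - \<i> * ((1 - q) / (1 + q))"
    using signed_sum_root_of_unity[of q M] q_root N \<open>1 + q \<noteq> 0\<close>
    by (simp add: nonzero_eq_divide_eq mult.commute)
  also have "\<dots> = of_nat N * complex_of_real (hilbert_kernel N n)"
  proof (cases "even n")
    case True
    then have "q = cis (2 * t)" by (simp add: q_def)
    then show ?thesis using True \<open>real N > 0\<close>
      by (simp only: cayley_cis_tan) (simp add: hilbert_kernel_def t_def)
  next
    case False
    then have "q = - cis (2 * t)" by (simp add: q_def)
    then show ?thesis using False \<open>real N > 0\<close>
      by (simp add: cayley_cis_cot) (simp add: hilbert_kernel_def t_def)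
  qed
  finally show ?thesis
    using \<open>real N > 0\<close> by (simp add: idft_def)
qed

theorem lemma3:
  fixes N :: nat and u :: "int \<Rightarrow> complex"
  assumes "odd N" and "periodic_fun_simple u (int N)"
  shows "discrete_hilbert N u = idft N (diag_apply (map (\<lambda>s. - \<i> * s) (S_odd N)) (dft N u))"
proof
  fix n
  let ?a = "\<lambda>k. map (\<lambda>s. - \<i> * s) (S_odd N) ! nat k"
  have "length (S_odd N) = N"
    using assms(1) by (auto simp: S_odd_def elim!: oddE)
  then have "idft N (diag_apply (map (\<lambda>s. - \<i> * s) (S_odd N)) (dft N u)) n =
      idft N (\<lambda>k. ?a k * dft N u k) n"
    unfolding idft_def by (intro arg_cong2[of _ _ _ _ "(*)"] sum.cong refl)
      (simp add: diag_apply_def Let_def)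
  also have "\<dots> = discrete_hilbert N u n"
    unfolding idft_mult_dft idft_S_odd[OF assms(1)] discrete_hilbert_def ..
  finally show "discrete_hilbert N u n =
      idft N (diag_apply (map (\<lambda>s. - \<i> * s) (S_odd N)) (dft N u)) n" ..
qed

end
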